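(* Let $\theta\in\mathbb R$ be such that $\tan\theta=\frac pq\in\mathbb Q\setminus\{0\}$, where $p,q$ are coprime integers. Let $g(t)=\left(t\cos\theta,\ t\sin\theta,\ \frac{t^2}{2}\sin\theta\cos\theta\right)\in G$ (in the coordinates $(a,b,c)$), $t\in\mathbb R$, let $\Gamma$ be the parametrized curve $t\mapsto\pi(g(t))\in M$, and let $\gamma$ be the parametrized curve $t\mapsto\rho(\pi(g(t)))\in\mathbb T^2$. Then the curve $\gamma$ is periodic with period $T=\frac{q}{\cos\theta}$. The curve $\Gamma$ is periodic either with the same period $T$ as $\gamma$, if at least one of the numbers $p,q$ is even, or with twice bigger period $2T$ otherwise (i.e. if both $p$ and $q$ are odd).
   Context: $G$ is the 3D Heisenberg group of real unipotent upper triangular matrices $\begin{pmatrix}1&a&c\\0&1&b\\0&0&1\end{pmatrix}$, identified with $\mathbb R^3$ via the coordinates $(a,b,c)$, so that $(a,b,c)\cdot(\bar a,\bar b,\bar c)=(a+\bar a,\,b+\bar b,\,c+\bar c+a\bar b)$. $H\subset G$ is the discrete subgroup of elements with $a,b,c\in\mathbb Z$. $M=H\backslash G=\{Hg\mid g\in G\}$ is the (compact) Heisenberg 3D nil-manifold and $\pi:G\to M$, $g\mapsto Hg$, is the projection. In terms of representatives in $[0,1)^3$, $\pi(a,b,c)=(\{a\},\{b\},\{c-[a]b\})$, where $[\cdot]$ and $\{\cdot\}$ are integer and fractional parts. The map $\rho:M\to\mathbb T^2=\mathbb R^2/\mathbb Z^2$ is induced by $(a,b,c)\mapsto(a,b)$.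 *)

theory Defs
  imports
    "HOL-Analysis.Analysis"
    "HOL-Algebra.Coset"
    "HOL-Library.Periodic_Fun"
begin

definition heis :: "real \<Rightarrow> real \<Rightarrow> real \<Rightarrow> real^3^3" where
  "heis a b c = vector [vector [1, a, c], vector [0, 1, b], vector [0, 0, 1]]"

definition heis_group :: "(real^3^3) monoid" where
  "heis_group = \<lparr>carrier = {heis a b c | a b c. True}, mult = (**), one = mat 1\<rparr>"

definition heis_int :: "(real^3^3) set" where
  "heis_int = {heis a b c | a b c. a \<in> \<int> \<and> b \<in> \<int> \<and> c \<in> \<int>}"

text \<open>The quotient \<open>H \ G\<close> is the set of cosets \<open>H g\<close>; these are the right cosets
  in the terminology of \<open>HOL-Algebra\<close>.\<close>

definition nil_manifold :: "(real^3^3) set set" where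
  "nil_manifold = rcosets\<^bsub>heis_group\<^esub> heis_int"

definition nil_proj :: "real^3^3 \<Rightarrow> (real^3^3) set" where
  "nil_proj g = heis_int #>\<^bsub>heis_group\<^esub> g"

definition plane_group :: "(real \<times> real) monoid" where
  "plane_group = \<lparr>carrier = UNIV, mult = (+), one = 0\<rparr>"

definition torus :: "(real \<times> real) set set" where
  "torus = rcosets\<^bsub>plane_group\<^esub> (\<int> \<times> \<int>)"

definition torus_proj :: "real \<times> real \<Rightarrow> (real \<times> real) set" where
  "torus_proj x = (\<int> \<times> \<int>) #>\<^bsub>plane_group\<^esub> x"

text \<open>The entries \<open>A $ 1 $ 2\<close> and \<open>A $ 2 $ 3\<close> are the coordinates \<open>a\<close> and \<open>b\<close>. All elements
  of a coset have the same image in the torus (lemma \<open>nil_to_torus_nil_proj\<close>), so that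
  \<open>the_elem\<close> is applied to a singleton.\<close>

definition nil_to_torus :: "(real^3^3) set \<Rightarrow> (real \<times> real) set" where
  "nil_to_torus X = the_elem ((\<lambda>A. torus_proj (A $ 1 $ 2, A $ 2 $ 3)) ` X)"

text \<open>\<open>T\<close> is a nonzero period of least absolute value. \<open>T\<close> may be negative: the number
  \<open>q / cos \<theta>\<close> is, when \<open>q\<close> and \<open>cos \<theta>\<close> have opposite signs.\<close>

definition has_minimal_period :: "(real \<Rightarrow> 'a) \<Rightarrow> real \<Rightarrow> bool" where
  "has_minimal_period f T \<longleftrightarrow>
     T \<noteq> 0 \<and> periodic_fun_simple f T \<and>
     (\<forall>s. s \<noteq> 0 \<and> periodic_fun_simple f s \<longrightarrow> \<bar>T\<bar> \<le> \<bar>s\<bar>)"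

lemma heis_nth [simp]:
  "heis a b c $ 1 $ 1 = 1" "heis a b c $ 1 $ 2 = a" "heis a b c $ 1 $ 3 = c"
  "heis a b c $ 2 $ 1 = 0" "heis a b c $ 2 $ 2 = 1" "heis a b c $ 2 $ 3 = b"
  "heis a b c $ 3 $ 1 = 0" "heis a b c $ 3 $ 2 = 0" "heis a b c $ 3 $ 3 = 1"
  by (simp_all add: heis_def)

lemma heis_eq_iff [simp]: "heis a b c = heis a' b' c' \<longleftrightarrow> a = a' \<and> b = b' \<and> c = c'"
  by (metis heis_nth)

lemma heis_mult: "heis a b c ** heis a' b' c' = heis (a + a') (b + b') (c + c' + a * b')"
  by (simp add: vec_eq_iff forall_3 matrix_matrix_mult_def sum_3)

lemma heis_one: "mat 1 = heis 0 0 0"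
  by (simp add: vec_eq_iff forall_3 mat_def)

lemma group_heis_group: "group heis_group"
proof (rule groupI)
  fix x assume "x \<in> carrier heis_group"
  then obtain a b c where x: "x = heis a b c"
    by (auto simp: heis_group_def)
  show "\<exists>y\<in>carrier heis_group. y \<otimes>\<^bsub>heis_group\<^esub> x = \<one>\<^bsub>heis_group\<^esub>"
    by (rule bexI[of _ "heis (- a) (- b) (a * b - c)"])
       (auto simp: heis_group_def heis_mult heis_one x)
qed (auto simp: heis_group_def heis_mult heis_one algebra_simps)

lemma subgroup_heis_int: "subgroup heis_int heis_group"
proof (rule group.subgroupI[OF group_heis_group])
  fix x assume "x \<in> heis_int"
  then obtain a b c where x: "x = heis a b c" and abc: "a \<in> \<int>" "b \<in> \<int>" "c \<in> \<int>"
    by (auto simp: heis_int_def)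
  have "inv\<^bsub>heis_group\<^esub> x = heis (- a) (- b) (a * b - c)"
    by (rule group.inv_equality[OF group_heis_group])
       (auto simp: heis_group_def heis_mult heis_one x)
  then show "inv\<^bsub>heis_group\<^esub> x \<in> heis_int"
    using abc by (auto simp: heis_int_def)
next
  have "heis 0 0 0 \<in> heis_int"
    by (force simp: heis_int_def)
  then show "heis_int \<noteq> {}"
    by blast
qed (auto simp: heis_int_def heis_group_def heis_mult)

lemma group_plane_group: "group plane_group"
proof (rule groupI)
  fix x assume "x \<in> carrier plane_group"
  show "\<exists>y\<in>carrier plane_group. y \<otimes>\<^bsub>plane_group\<^esub> x = \<one>\<^bsub>plane_group\<^esub>"
    by (rule bexI[of _ "- x"]) (auto simp: plane_group_def)
qed (auto simp: plane_group_def add.assoc)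

lemma subgroup_int_plane_group: "subgroup (\<int> \<times> \<int>) plane_group"
proof (rule group.subgroupI[OF group_plane_group])
  fix x :: "real \<times> real" assume x: "x \<in> \<int> \<times> \<int>"
  have "inv\<^bsub>plane_group\<^esub> x = - x"
    by (rule group.inv_equality[OF group_plane_group]) (auto simp: plane_group_def)
  then show "inv\<^bsub>plane_group\<^esub> x \<in> \<int> \<times> \<int>"
    using x by auto
qed (auto simp: plane_group_def)

lemma nil_proj_image: "nil_proj ` carrier heis_group = nil_manifold"
  by (auto simp: nil_proj_def nil_manifold_def RCOSETS_def)

lemma torus_proj_image: "range torus_proj = torus"
  by (auto simp: torus_proj_def torus_def RCOSETS_def plane_group_def)

lemma torus_proj_shift:
  assumes "m \<in> \<int>" "n \<in> \<int>"
  shows "torus_proj (m + x, n + y) = torus_proj (x, y)"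
proof -
  interpret group plane_group by (rule group_plane_group)
  have "(m + x, n + y) \<in> torus_proj (x, y)"
    using assms by (auto simp: torus_proj_def r_coset_def plane_group_def)
  then show ?thesis
    unfolding torus_proj_def
    by (intro repr_independence[symmetric] subgroup_int_plane_group) (auto simp: plane_group_def)
qed

lemma nil_to_torus_nil_proj: "nil_to_torus (nil_proj (heis a b c)) = torus_proj (a, b)"
proof -
  have "(\<lambda>A. torus_proj (A $ 1 $ 2, A $ 2 $ 3)) ` nil_proj (heis a b c) = {torus_proj (a, b)}"
  proof (intro equalityI subsetI)
    fix X assume "X \<in> (\<lambda>A. torus_proj (A $ 1 $ 2, A $ 2 $ 3)) ` nil_proj (heis a b c)"
    then show "X \<in> {torus_proj (a, b)}"
      by (auto simp: nil_proj_def r_coset_def heis_group_def heis_int_def heis_mult torus_proj_shift)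
  next
    have "heis 0 0 0 \<in> heis_int"
      by (force simp: heis_int_def)
    then have "heis a b c \<in> nil_proj (heis a b c)"
      by (force simp: nil_proj_def r_coset_def heis_group_def heis_mult)
    then show "X \<in> (\<lambda>A. torus_proj (A $ 1 $ 2, A $ 2 $ 3)) ` nil_proj (heis a b c)"
      if "X \<in> {torus_proj (a, b)}" for X
      using that by (force intro!: image_eqI[of _ _ "heis a b c"])
  qed
  then show ?thesis
    by (simp add: nil_to_torus_def)
qed

end

theory Submission
  imports Defs
begin

text \<open>
  The curve \<open>g\<close> is a one-parameter subgroup of \<open>G\<close>: the third coordinate \<open>t\<^sup>2 / 2 \<sqdot> sin \<theta> cos \<theta>\<close> is
  exactly what makes \<open>g (s + t) = g s \<sqdot> g t\<close>. Hence \<open>H g(t + s) = H g(s) g(t)\<close>, and this equals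
  \<open>H g(t)\<close> for all \<open>t\<close> iff \<open>g s \<in> H\<close> (lemma \<open>periodic_one_parameter_coset_iff\<close>). The same
  argument in \<open>\<real>\<^sup>2\<close> describes the periods of \<open>\<gamma>\<close>. So determining the periods means determining
  when the coordinates of \<open>g s\<close> are integers.

  The line through the origin with slope \<open>p / q\<close> meets \<open>\<int>\<^sup>2\<close> in the integer multiples of \<open>(q, p)\<close>,
  because \<open>p\<close> and \<open>q\<close> are coprime; these points correspond to the parameters \<open>s = k T\<close> with \<open>k\<close> an
  integer, so the periods of \<open>\<gamma>\<close> are the multiples of \<open>T\<close>. At \<open>s = k T\<close> the third coordinate of
  \<open>g s\<close> is half the product of the first two, which is \<open>k\<^sup>2 p q / 2\<close>. It is an integer for every
  \<open>k\<close> when \<open>p q\<close> is even, and only for even \<open>k\<close> when \<open>p q\<close> is odd. So the periods of \<open>\<Gamma>\<close> are the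
  multiples of \<open>T\<close> in the first case and those of \<open>2 T\<close> in the second.
\<close>

lemma has_minimal_periodI:
  assumes "T \<noteq> 0"
    and periods: "\<And>s. periodic_fun_simple f s \<longleftrightarrow> (\<exists>k::int. s = of_int k * T)"
  shows "has_minimal_period f T"
proof -
  have "periodic_fun_simple f T"
    unfolding periods by (rule exI[of _ 1]) simp
  moreover have "\<bar>T\<bar> \<le> \<bar>s\<bar>" if "s \<noteq> 0" and period: "periodic_fun_simple f s" for s
  proof -
    obtain k :: int where k: "s = of_int k * T"
      using period periods by blast
    with \<open>s \<noteq> 0\<close> have "1 \<le> \<bar>k\<bar>"
      by auto
    then have "1 \<le> \<bar>real_of_int k\<bar>"
      by linarith
    then show ?thesis
      using mult_right_mono[of 1 "\<bar>real_of_int k\<bar>" "\<bar>T\<bar>"] by (simp add: k abs_mult)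
  qed
  ultimately show ?thesis
    using \<open>T \<noteq> 0\<close> by (simp add: has_minimal_period_def)
qed

text \<open>Time \<open>0\<close> decides: \<open>\<phi> 0\<close> is the identity, so a period \<open>s\<close> gives \<open>H \<phi>(s) = H\<close>. Conversely this
  equation can be translated on the right by any \<open>\<phi> t\<close>; because \<open>\<phi>\<close> is a homomorphism on a commutative
  group, \<open>\<phi> s\<close> may be placed next to \<open>H\<close> although the group itself need not be commutative.\<close>

lemma periodic_one_parameter_coset_iff:
  fixes \<phi> :: "real \<Rightarrow> 'a" and G (structure)
  assumes "group G" and H: "subgroup H G"
    and carrier: "\<And>t. \<phi> t \<in> carrier G"
    and add: "\<And>s t. \<phi> (s + t) = \<phi> s \<otimes> \<phi> t"
  shows "periodic_fun_simple (\<lambda>t. H #> \<phi> t) s \<longleftrightarrow> \<phi> s \<in> H"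
proof -
  interpret group G by fact
  have H_sub: "H \<subseteq> carrier G"
    by (rule subgroup.subset[OF H])
  have "\<phi> 0 = \<one>"
    using add[of 0 0] carrier[of 0] by simp
  show ?thesis
  proof
    assume "periodic_fun_simple (\<lambda>t. H #> \<phi> t) s"
    then have "H #> \<phi> (0 + s) = H #> \<phi> 0"
      by (rule periodic_fun_simple.plus_period)
    then have "H #> \<phi> s = H"
      using \<open>\<phi> 0 = \<one>\<close> H_sub by simp
    then show "\<phi> s \<in> H"
      by (rule coset_join1) (use carrier H in auto)
  next
    assume "\<phi> s \<in> H"
    then have fixed: "H #> \<phi> s = H"
      by (intro coset_join2 carrier H)
    show "periodic_fun_simple (\<lambda>t. H #> \<phi> t) s"
    proof
      fix t
      have "H #> \<phi> (t + s) = H #> \<phi> s #> \<phi> t"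
        by (simp only: add.commute[of t s] add coset_mult_assoc[OF H_sub carrier carrier])
      then show "H #> \<phi> (t + s) = H #> \<phi> t"
        by (simp add: fixed)
    qed
  qed
qed

lemma heis_mem_heis_int_iff: "heis a b c \<in> heis_int \<longleftrightarrow> a \<in> \<int> \<and> b \<in> \<int> \<and> c \<in> \<int>"
  by (auto simp: heis_int_def)

text \<open>The third coordinate is half the product of the other two, which is the quadratic correction
  that turns a straight line in the \<open>(a, b)\<close>-plane into a homomorphism to \<open>G\<close>.\<close>

lemma periodic_nil_proj_line_iff:
  "periodic_fun_simple (\<lambda>t. nil_proj (heis (t * a) (t * b) (t\<^sup>2 / 2 * b * a))) s \<longleftrightarrow>
    s * a \<in> \<int> \<and> s * b \<in> \<int> \<and> (s * a) * (s * b) / 2 \<in> \<int>"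
proof -
  have "periodic_fun_simple (\<lambda>t. nil_proj (heis (t * a) (t * b) (t\<^sup>2 / 2 * b * a))) s \<longleftrightarrow>
      heis (s * a) (s * b) (s\<^sup>2 / 2 * b * a) \<in> heis_int"
    unfolding nil_proj_def
  proof (rule periodic_one_parameter_coset_iff[OF group_heis_group subgroup_heis_int])
    show "heis (t * a) (t * b) (t\<^sup>2 / 2 * b * a) \<in> carrier heis_group" for t
      by (simp add: heis_group_def del: heis_eq_iff) blast
  qed (simp add: heis_group_def heis_mult power2_eq_square field_simps)
  also have "s\<^sup>2 / 2 * b * a = (s * a) * (s * b) / 2"
    by (simp add: power2_eq_square)
  finally show ?thesis
    by (simp add: heis_mem_heis_int_iff)
qed

lemma periodic_torus_proj_line_iff:
  "periodic_fun_simple (\<lambda>t. torus_proj (t * a, t * b)) s \<longleftrightarrow> s * a \<in> \<int> \<and> s * b \<in> \<int>"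
proof -
  have "periodic_fun_simple (\<lambda>t. torus_proj (t * a, t * b)) s \<longleftrightarrow> (s * a, s * b) \<in> \<int> \<times> \<int>"
    unfolding torus_proj_def
    by (rule periodic_one_parameter_coset_iff[OF group_plane_group subgroup_int_plane_group])
       (auto simp: plane_group_def distrib_right)
  then show ?thesis
    by simp
qed

lemma lattice_points_on_rational_line:
  fixes p q :: int and x y :: real
  assumes "q \<noteq> 0" "coprime p q" and slope: "of_int q * y = of_int p * x"
  shows "x \<in> \<int> \<and> y \<in> \<int> \<longleftrightarrow> (\<exists>k::int. x = of_int (k * q))"
proof
  assume "x \<in> \<int> \<and> y \<in> \<int>"
  then obtain m n :: int where x: "x = of_int m" and y: "y = of_int n"
    by (auto elim!: Ints_cases)
  have "q * n = p * m"
    using slope unfolding x y by (metis of_int_eq_iff of_int_mult)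
  then have "q dvd p * m"
    by (metis dvd_triv_left)
  then have "q dvd m"
    using \<open>coprime p q\<close> by (simp add: coprime_commute coprime_dvd_mult_right_iff)
  then show "\<exists>k::int. x = of_int (k * q)"
    unfolding x by (metis dvdE mult.commute)
next
  assume "\<exists>k::int. x = of_int (k * q)"
  then obtain k :: int where x: "x = of_int (k * q)"
    by blast
  then have "of_int q * y = of_int q * of_int (k * p)"
    using slope by (simp add: algebra_simps)
  then have "y = of_int (k * p)"
    using \<open>q \<noteq> 0\<close> by (metis mult_left_cancel of_int_eq_0_iff)
  then show "x \<in> \<int> \<and> y \<in> \<int>"
    by (simp only: x Ints_of_int)
qed

lemma of_int_half_in_Ints_iff: "(of_int n :: real) / 2 \<in> \<int> \<longleftrightarrow> even n"
proof
  assume "(of_int n :: real) / 2 \<in> \<int>"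
  then obtain m where "(of_int n :: real) / 2 = of_int m"
    by (auto elim: Ints_cases)
  then have "(of_int n :: real) = of_int (2 * m)"
    by simp
  then show "even n"
    by (metis dvd_triv_left of_int_eq_iff)
qed auto

theorem proposition5p2:
  fixes \<theta> T :: real and p q :: int
    and g :: "real \<Rightarrow> real^3^3"
    and \<Gamma> :: "real \<Rightarrow> (real^3^3) set"
    and \<gamma> :: "real \<Rightarrow> (real \<times> real) set"
  assumes tan: "tan \<theta> = real_of_int p / real_of_int q"
    and "p \<noteq> 0" and "q \<noteq> 0" and "coprime p q"
    and g: "\<And>t. g t = heis (t * cos \<theta>) (t * sin \<theta>) (t\<^sup>2 / 2 * sin \<theta> * cos \<theta>)"
    and \<Gamma>: "\<And>t. \<Gamma> t = nil_proj (g t)"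
    and \<gamma>: "\<And>t. \<gamma> t = nil_to_torus (nil_proj (g t))"
    and T: "T = real_of_int q / cos \<theta>"
  shows "has_minimal_period \<gamma> T \<and>
         (even p \<or> even q \<longrightarrow> has_minimal_period \<Gamma> T) \<and>
         (odd p \<and> odd q \<longrightarrow> has_minimal_period \<Gamma> (2 * T))"
proof -
  \<comment> \<open>\<open>tan \<theta>\<close> would be \<open>0\<close> by the convention for division by zero if \<open>cos \<theta>\<close> were \<open>0\<close>.\<close>
  have cos: "cos \<theta> \<noteq> 0"
    using tan \<open>p \<noteq> 0\<close> \<open>q \<noteq> 0\<close> by (auto simp: tan_def)
  have slope: "of_int q * sin \<theta> = of_int p * cos \<theta>"
    using tan cos \<open>q \<noteq> 0\<close> by (simp add: tan_def field_simps)
  have "T \<noteq> 0"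
    using T cos \<open>q \<noteq> 0\<close> by simp
  have T_cos: "T * cos \<theta> = of_int q"
    using T cos by simp
  have T_sin: "T * sin \<theta> = of_int p"
  proof -
    have "T * sin \<theta> = (of_int q * sin \<theta>) / cos \<theta>"
      by (simp add: T)
    also have "\<dots> = of_int p"
      unfolding slope using cos by simp
    finally show ?thesis .
  qed

  have lattice_times: "s * cos \<theta> \<in> \<int> \<and> s * sin \<theta> \<in> \<int> \<longleftrightarrow> (\<exists>k::int. s = of_int k * T)" for s
  proof -
    have "of_int q * (s * sin \<theta>) = of_int p * (s * cos \<theta>)"
      using slope by (simp add: mult.left_commute)
    then have "s * cos \<theta> \<in> \<int> \<and> s * sin \<theta> \<in> \<int> \<longleftrightarrow> (\<exists>k::int. s * cos \<theta> = of_int (k * q))"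
      by (rule lattice_points_on_rational_line[OF \<open>q \<noteq> 0\<close> \<open>coprime p q\<close>])
    also have "\<dots> \<longleftrightarrow> (\<exists>k::int. s = of_int k * T)"
      using cos by (simp add: T field_simps)
    finally show ?thesis .
  qed

  have "\<gamma> = (\<lambda>t. torus_proj (t * cos \<theta>, t * sin \<theta>))"
    by (simp add: \<gamma> g nil_to_torus_nil_proj fun_eq_iff)
  then have "has_minimal_period \<gamma> T"
    using \<open>T \<noteq> 0\<close>
    by (intro has_minimal_periodI) (simp_all add: periodic_torus_proj_line_iff lattice_times)

  have third: "(of_int k * T * cos \<theta>) * (of_int k * T * sin \<theta>) / 2 \<in> \<int> \<longleftrightarrow>
      even (k\<^sup>2 * (p * q))" for k :: int
  proof -
    have "(of_int k * T * cos \<theta>) * (of_int k * T * sin \<theta>) =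
        (of_int k)\<^sup>2 * ((T * cos \<theta>) * (T * sin \<theta>))"
      by (simp add: power2_eq_square)
    also have "\<dots> = of_int (k\<^sup>2 * (p * q))"
      unfolding T_cos T_sin by simp
    finally have "(of_int k * T * cos \<theta>) * (of_int k * T * sin \<theta>) = of_int (k\<^sup>2 * (p * q))" .
    then show ?thesis
      by (simp only: of_int_half_in_Ints_iff)
  qed
  have "\<Gamma> = (\<lambda>t. nil_proj (heis (t * cos \<theta>) (t * sin \<theta>) (t\<^sup>2 / 2 * sin \<theta> * cos \<theta>)))"
    by (simp add: \<Gamma> g fun_eq_iff)
  then have \<Gamma>_iff: "periodic_fun_simple \<Gamma> s \<longleftrightarrow>
      s * cos \<theta> \<in> \<int> \<and> s * sin \<theta> \<in> \<int> \<and> (s * cos \<theta>) * (s * sin \<theta>) / 2 \<in> \<int>" for s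
    by (simp only: periodic_nil_proj_line_iff)
  have \<Gamma>_periods: "periodic_fun_simple \<Gamma> s \<longleftrightarrow>
      (\<exists>k::int. s = of_int k * T \<and> even (k\<^sup>2 * (p * q)))" for s
  proof -
    have "periodic_fun_simple \<Gamma> s \<longleftrightarrow>
        (\<exists>k::int. s = of_int k * T) \<and> (s * cos \<theta>) * (s * sin \<theta>) / 2 \<in> \<int>"
      unfolding \<Gamma>_iff using lattice_times[of s] by argo
    also have "\<dots> \<longleftrightarrow> (\<exists>k::int. s = of_int k * T \<and> even (k\<^sup>2 * (p * q)))"
      by (auto simp only: third)
    finally show ?thesis .
  qed

  have "has_minimal_period \<Gamma> T" if "even p \<or> even q"
    using \<open>T \<noteq> 0\<close> that by (intro has_minimal_periodI) (auto simp: \<Gamma>_periods)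
  moreover have "has_minimal_period \<Gamma> (2 * T)" if "odd p \<and> odd q"
  proof (rule has_minimal_periodI)
    fix s
    have "periodic_fun_simple \<Gamma> s \<longleftrightarrow> (\<exists>k::int. s = of_int k * T \<and> even k)"
      using that by (simp add: \<Gamma>_periods)
    also have "\<dots> \<longleftrightarrow> (\<exists>j::int. s = of_int j * (2 * T))"
    proof
      assume "\<exists>k::int. s = of_int k * T \<and> even k"
      then obtain k :: int where "s = of_int k * T" "even k"
        by blast
      then have "s = of_int (k div 2) * (2 * T)"
        by (auto elim!: evenE)
      then show "\<exists>j::int. s = of_int j * (2 * T)" ..
    next
      assume "\<exists>j::int. s = of_int j * (2 * T)"
      then obtain j :: int where "s = of_int j * (2 * T)" ..
      then show "\<exists>k::int. s = of_int k * T \<and> even k"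
        by (intro exI[of _ "2 * j"]) simp
    qed
    finally show "periodic_fun_simple \<Gamma> s \<longleftrightarrow> (\<exists>j::int. s = of_int j * (2 * T))" .
  qed (use \<open>T \<noteq> 0\<close> in simp)
  ultimately show ?thesis
    using \<open>has_minimal_period \<gamma> T\<close> by blast
qed

end
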